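(* Let $n\ge2$. Suppose that the distribution $F$ on $\mathbb R$ is $n$-completely mixable with finite variance, and that $\mathcal M$ is a symmetric set of probabilities on $2^{[n]}$. Then each NCD joint mix with marginals $F$ and correlation matrix $P_n^*$ is a minimizer of the problem $$\text{to minimize}\quad \sup_{\mu\in\mathcal M}\ \sum_{K\subseteq[n]}\mathbb E\left[\left(\sum_{i\in K}X_i\right)^2\right]\mu(K)\quad\text{subject to } X_i\sim F,\ i\in[n],$$ where the minimization is over all random vectors $(X_1,\dots,X_n)$ satisfying the constraint.
   Context: $[n]=\{1,\dots,n\}$; $2^{[n]}$ is the power set of $[n]$; for a probability $\mu$ on the sample space $2^{[n]}$ write $\mu(K)=\mu(\{K\})$; the sum over the empty set is $0$. A (nonempty) set $\mathcal M$ of probabilities on $2^{[n]}$ is symmetric if $\mu\in\mathcal M$ implies $\mu_\pi\in\mathcal M$ for every permutation $\pi$ of $[n]$, where $\mu_\pi(K)=\mu(\{\pi(i):i\in K\})$ for $K\subseteq[n]$. A random vector $(X_1,\dots,X_n)$ is a joint mix if $\sum_{i=1}^nX_i$ is almost surely equal to a constant. $F$ is $n$-completely mixable if there is a joint mix $(X_1,\dots,X_n)$ with $X_i\sim F$ for all $i\in[n]$. A random vector is negative correlation dependent (NCD) if $\mathrm{Cov}(X_i,X_j)\le0$ for all $i\ne j$. $P_n^*$ is the $n\times n$ matrix with diagonal entries $1$ and off-diagonal entries $-1/(n-1)$; for identical marginals with variance $\sigma^2$, having correlation matrix $P_n^*$ means having covariance matrix $\sigma^2P_n^*$. *)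

theory Defs
  imports "HOL-Probability.Probability" "HOL-Combinatorics.Permutations"
begin

text \<open>
  A random vector \<open>(X\<^sub>1, \<dots>, X\<^sub>n)\<close> is a family \<open>X\<close> of real functions on a probability space \<open>P\<close>; only
  the components with index in \<open>{1..n}\<close> matter.
\<close>

definition random_vector :: "nat \<Rightarrow> 'a measure \<Rightarrow> (nat \<Rightarrow> 'a \<Rightarrow> real) \<Rightarrow> bool" where
  "random_vector n P X \<longleftrightarrow> prob_space P \<and> (\<forall>i\<in>{1..n}. X i \<in> borel_measurable P)"

definition has_marginals :: "nat \<Rightarrow> real measure \<Rightarrow> 'a measure \<Rightarrow> (nat \<Rightarrow> 'a \<Rightarrow> real) \<Rightarrow> bool" where
  "has_marginals n F P X \<longleftrightarrow> random_vector n P X \<and> (\<forall>i\<in>{1..n}. distr P borel (X i) = F)"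

definition joint_mix :: "nat \<Rightarrow> 'a measure \<Rightarrow> (nat \<Rightarrow> 'a \<Rightarrow> real) \<Rightarrow> bool" where
  "joint_mix n P X \<longleftrightarrow> random_vector n P X \<and> (\<exists>c. AE \<omega> in P. (\<Sum>i\<in>{1..n}. X i \<omega>) = c)"

text \<open>
  The sample space is taken over \<^typ>\<open>nat \<Rightarrow> real\<close>. This is no restriction, because the property
  only concerns the joint law of the vector, and every vector has a copy in law on this type.
\<close>

definition completely_mixable :: "nat \<Rightarrow> real measure \<Rightarrow> bool" where
  "completely_mixable n F \<longleftrightarrow>
     (\<exists>(P :: (nat \<Rightarrow> real) measure) X. joint_mix n P X \<and> has_marginals n F P X)"

text \<open>
  Integrability of both integrands is required, since the Bochner integral of a non-integrable
  function is \<open>0\<close>.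
\<close>

definition finite_variance :: "real measure \<Rightarrow> bool" where
  "finite_variance F \<longleftrightarrow>
     integrable F (\<lambda>x. x) \<and> integrable F (\<lambda>x. (x - integral\<^sup>L F (\<lambda>y. y))\<^sup>2)"

definition covariance :: "'a measure \<Rightarrow> ('a \<Rightarrow> real) \<Rightarrow> ('a \<Rightarrow> real) \<Rightarrow> real" where
  "covariance P U V =
     integral\<^sup>L P (\<lambda>\<omega>. (U \<omega> - integral\<^sup>L P U) * (V \<omega> - integral\<^sup>L P V))"

definition neg_corr_dependent :: "nat \<Rightarrow> 'a measure \<Rightarrow> (nat \<Rightarrow> 'a \<Rightarrow> real) \<Rightarrow> bool" where
  "neg_corr_dependent n P X \<longleftrightarrow>
     random_vector n P X \<and>
     (\<forall>i\<in>{1..n}. \<forall>j\<in>{1..n}. i \<noteq> j \<longrightarrow> covariance P (X i) (X j) \<le> 0)"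

definition P_star :: "nat \<Rightarrow> nat \<Rightarrow> nat \<Rightarrow> real" where
  "P_star n i j = (if i = j then 1 else - 1 / (real n - 1))"

text \<open>
  For identical marginals \<open>F\<close> with variance \<open>\<sigma>\<^sup>2\<close>, the correlation matrix is \<open>R\<close> if the covariance matrix
  is \<open>\<sigma>\<^sup>2 R\<close>; this convention also covers degenerate \<open>F\<close>.
\<close>

definition has_correlation_matrix ::
    "nat \<Rightarrow> real measure \<Rightarrow> 'a measure \<Rightarrow> (nat \<Rightarrow> 'a \<Rightarrow> real) \<Rightarrow> (nat \<Rightarrow> nat \<Rightarrow> real) \<Rightarrow> bool" where
  "has_correlation_matrix n F P X R \<longleftrightarrow>
     (\<forall>i\<in>{1..n}. \<forall>j\<in>{1..n}.
        covariance P (X i) (X j) = integral\<^sup>L F (\<lambda>x. (x - integral\<^sup>L F (\<lambda>y. y))\<^sup>2) * R i j)"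

text \<open>
  A probability on the power set of \<open>{1..n}\<close> is a \<open>pmf\<close> on sets of naturals supported in
  \<open>Pow {1..n}\<close>. The rearrangement \<open>\<mu>\<^sub>\<pi>\<close> is an image measure whose weights are given by
  \<open>pmf_permute_prob\<close> below.
\<close>

definition permute_prob :: "(nat \<Rightarrow> nat) \<Rightarrow> nat set pmf \<Rightarrow> nat set pmf" where
  "permute_prob \<pi> \<mu> = map_pmf (\<lambda>K. inv \<pi> ` K) \<mu>"

lemma pmf_permute_prob:
  assumes "\<pi> permutes {1..n}"
  shows "pmf (permute_prob \<pi> \<mu>) K = pmf \<mu> (\<pi> ` K)"
proof -
  have "bij \<pi>" using assms by (rule permutes_bij)
  then have "inj (\<lambda>K. inv \<pi> ` K)" and "inv \<pi> ` \<pi> ` K = K"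
    by (simp_all add: bij_imp_bij_inv bij_is_inj inj_on_image image_inv_f_f)
  then show ?thesis
    unfolding permute_prob_def by (metis pmf_map_inj')
qed

definition symmetric_probs :: "nat \<Rightarrow> nat set pmf set \<Rightarrow> bool" where
  "symmetric_probs n M \<longleftrightarrow>
     M \<noteq> {} \<and> (\<forall>\<mu>\<in>M. set_pmf \<mu> \<subseteq> Pow {1..n}) \<and>
     (\<forall>\<mu>\<in>M. \<forall>\<pi>. \<pi> permutes {1..n} \<longrightarrow> permute_prob \<pi> \<mu> \<in> M)"

text \<open>
  The expectations are those of nonnegative random variables, taken in \<open>[0, \<infinity>]\<close>, so that neither they
  nor the supremum depend on integrability or boundedness.
\<close>

definition objective ::
    "nat \<Rightarrow> nat set pmf set \<Rightarrow> 'a measure \<Rightarrow> (nat \<Rightarrow> 'a \<Rightarrow> real) \<Rightarrow> ennreal" where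
  "objective n M P X =
     (SUP \<mu>\<in>M. \<Sum>K\<in>Pow {1..n}.
        (\<integral>\<^sup>+ \<omega>. ennreal ((\<Sum>i\<in>K. X i \<omega>)\<^sup>2) \<partial>P) * ennreal (pmf \<mu> K))"

end

theory Submission
  imports Defs
begin

text \<open>
  Permutations of \<open>S\<close> act doubly transitively, so averaging \<open>(\<Sum>i\<in>\<pi> ` K. y i)\<^sup>2\<close> over all \<open>\<pi>\<close> gives a
  combination of \<open>\<Sum>i\<in>S. (y i)\<^sup>2\<close> and \<open>(\<Sum>i\<in>S. y i)\<^sup>2\<close>, with nonnegative coefficients depending only on
  \<open>card K\<close>. The expectation of the first sum is fixed by the marginals, and that of the second is at
  least the square of the total mean. The average over the orbit of any \<open>\<mu>\<close> in \<open>M\<close> therefore bounds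
  the objective from below, and under the correlation matrix \<open>P_star\<close> every single term attains the
  bound.
\<close>

section \<open>Averaging squared partial sums over permutations\<close>

text \<open>Two transpositions suffice. The first takes \<open>i\<close> to \<open>i'\<close> and
  \<open>j\<close> to some point other than \<open>i'\<close>; the second takes that point to
  \<open>j'\<close> and fixes \<open>i'\<close>, since \<open>j'\<close> differs from
  \<open>i'\<close> too.\<close>

lemma permutes_doubly_transitive:
  assumes "i \<in> S" "j \<in> S" "i \<noteq> j" "i' \<in> S" "j' \<in> S" "i' \<noteq> j'"
  obtains \<rho> where "\<rho> permutes S" "\<rho> i = i'" "\<rho> j = j'"
proof
  let ?\<tau> = "Transposition.transpose i i'"
  let ?\<rho> = "Transposition.transpose (?\<tau> j) j' \<circ> ?\<tau>"
  have "?\<tau> permutes S" using assms by (intro permutes_swap_id)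
  moreover have "?\<tau> j \<in> S" using assms by (auto simp: Transposition.transpose_def)
  ultimately show "?\<rho> permutes S"
    using assms by (intro permutes_compose permutes_swap_id)
  show "?\<rho> i = i'" "?\<rho> j = j'" using assms by (auto simp: Transposition.transpose_def)
qed

lemma sum_square_eq_diag_offdiag:
  fixes f :: "'i \<Rightarrow> real"
  assumes "finite A"
  shows "(\<Sum>i\<in>A. f i)\<^sup>2 = (\<Sum>i\<in>A. (f i)\<^sup>2) + (\<Sum>i\<in>A. \<Sum>j\<in>A - {i}. f i * f j)"
proof -
  have "(\<Sum>i\<in>A. f i)\<^sup>2 = (\<Sum>i\<in>A. \<Sum>j\<in>A. f i * f j)"
    by (simp add: power2_eq_square sum_product)
  also have "\<dots> = (\<Sum>i\<in>A. (f i)\<^sup>2 + (\<Sum>j\<in>A - {i}. f i * f j))"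
    by (rule sum.cong) (auto simp: sum.remove[OF assms] power2_eq_square)
  finally show ?thesis by (simp add: sum.distrib)
qed

text \<open>Expanding the square leaves two unknowns: the orbit sum \<open>A\<close> of the squares
  and the orbit sum \<open>B\<close> of the products at distinct points. The case of the full set
  \<open>S\<close>, where permuting changes nothing, determines both.\<close>

lemma sum_permutations_square:
  fixes y :: "'i \<Rightarrow> real"
  assumes "finite S" "2 \<le> card S" "K \<subseteq> S"
  defines "N \<equiv> real (card S)" and "k \<equiv> real (card K)"
  shows "(\<Sum>\<pi> | \<pi> permutes S. (\<Sum>i\<in>\<pi> ` K. y i)\<^sup>2) =
    fact (card S) * (k * (N - k) / (N * (N - 1)) * (\<Sum>i\<in>S. (y i)\<^sup>2)
      + k * (k - 1) / (N * (N - 1)) * (\<Sum>i\<in>S. y i)\<^sup>2)"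
proof -
  let ?Perm = "{\<pi>. \<pi> permutes S}"
  have finK: "finite K" using assms(1,3) finite_subset by auto
  have cardP: "card ?Perm = fact (card S)" using card_permutations assms(1) by blast
  obtain a b where ab: "a \<in> S" "b \<in> S" "a \<noteq> b"
    using assms(1,2) using card_le_Suc0_iff_eq[OF assms(1)] by fastforce
  define A B where "A = (\<Sum>\<pi>\<in>?Perm. (y (\<pi> a))\<^sup>2)" and "B = (\<Sum>\<pi>\<in>?Perm. y (\<pi> a) * y (\<pi> b))"
  \<comment> \<open>Composing every permutation with a fixed \<open>\<rho>\<close> that takes
    \<open>(a, b)\<close> to \<open>(i, j)\<close> only reindexes the sum, so the choice of the two
    points is immaterial.\<close>
  have offdiag: "(\<Sum>\<pi>\<in>?Perm. y (\<pi> i) * y (\<pi> j)) = B" if ij: "i \<in> S" "j \<in> S" "i \<noteq> j" for i j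
  proof -
    obtain \<rho> where \<rho>: "\<rho> permutes S" "\<rho> a = i" "\<rho> b = j"
      using permutes_doubly_transitive ab ij by metis
    show ?thesis
      using sum_permutations_compose_right[OF \<rho>(1), of "\<lambda>\<pi>. y (\<pi> a) * y (\<pi> b)"] \<rho>(2,3)
      by (simp add: B_def)
  qed
  have diag: "(\<Sum>\<pi>\<in>?Perm. (y (\<pi> i))\<^sup>2) = A" if i: "i \<in> S" for i
    using sum_permutations_compose_right[OF permutes_swap_id[OF ab(1) i], of "\<lambda>\<pi>. (y (\<pi> a))\<^sup>2"]
    by (simp add: A_def)
  \<comment> \<open>Stated for arbitrary \<open>L\<close> because it is used twice: for
    \<open>S\<close>, to relate \<open>A\<close> and \<open>B\<close> to the total, and for
    \<open>K\<close>.\<close>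
  have main: "(\<Sum>\<pi>\<in>?Perm. (\<Sum>i\<in>\<pi> ` L. y i)\<^sup>2) = card L * A + real (card L) * (real (card L) - 1) * B"
    if L: "L \<subseteq> S" for L
  proof -
    have finL: "finite L" using assms(1) L finite_subset by auto
    have "(\<Sum>\<pi>\<in>?Perm. (\<Sum>i\<in>\<pi> ` L. y i)\<^sup>2) = (\<Sum>\<pi>\<in>?Perm. (\<Sum>i\<in>L. y (\<pi> i))\<^sup>2)"
      by (intro sum.cong refl) (simp add: sum.reindex permutes_inj_on)
    also have "\<dots> = (\<Sum>\<pi>\<in>?Perm. \<Sum>i\<in>L. (y (\<pi> i))\<^sup>2)
        + (\<Sum>\<pi>\<in>?Perm. \<Sum>i\<in>L. \<Sum>j\<in>L - {i}. y (\<pi> i) * y (\<pi> j))"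
      by (simp add: sum_square_eq_diag_offdiag[OF finL] sum.distrib)
    also have "(\<Sum>\<pi>\<in>?Perm. \<Sum>i\<in>L. (y (\<pi> i))\<^sup>2) = (\<Sum>i\<in>L. \<Sum>\<pi>\<in>?Perm. (y (\<pi> i))\<^sup>2)"
      by (rule sum.swap)
    also have "\<dots> = (\<Sum>i\<in>L. A)" using L by (intro sum.cong refl diag) auto
    also have "(\<Sum>\<pi>\<in>?Perm. \<Sum>i\<in>L. \<Sum>j\<in>L - {i}. y (\<pi> i) * y (\<pi> j)) =
        (\<Sum>i\<in>L. \<Sum>\<pi>\<in>?Perm. \<Sum>j\<in>L - {i}. y (\<pi> i) * y (\<pi> j))"
      by (rule sum.swap)
    also have "\<dots> = (\<Sum>i\<in>L. \<Sum>j\<in>L - {i}. \<Sum>\<pi>\<in>?Perm. y (\<pi> i) * y (\<pi> j))"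
      by (intro sum.cong refl sum.swap)
    also have "\<dots> = (\<Sum>i\<in>L. \<Sum>j\<in>L - {i}. B)"
      using L by (intro sum.cong refl offdiag) auto
    also have "\<dots> = (\<Sum>i\<in>L. (real (card L) - 1) * B)"
    proof (intro sum.cong refl)
      fix i assume "i \<in> L"
      \<comment> \<open>The cardinality of \<open>L - {i}\<close> is a truncated difference of
        naturals; nonemptiness of \<open>L\<close> makes it agree with the real one.\<close>
      then have "card L \<ge> 1" using finL by (metis One_nat_def Suc_leI card_gt_0_iff empty_iff)
      then show "(\<Sum>j\<in>L - {i}. B) = (real (card L) - 1) * B"
        using \<open>i \<in> L\<close> finL by (simp add: of_nat_diff)
    qed
    finally show ?thesis by (simp add: mult.assoc)
  qed
  have permS: "\<pi> ` S = S" if "\<pi> \<in> ?Perm" for \<pi> using that permutes_image by auto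
  have sumS: "fact (card S) * (\<Sum>i\<in>S. y i)\<^sup>2 = N * A + N * (N - 1) * B"
    using main[of S] by (simp add: permS cardP N_def)
  \<comment> \<open>Since \<open>A\<close> is the same for every point, summing it over
    \<open>S\<close> recovers the full sum of squares, which each permutation preserves.\<close>
  have "N * A = (\<Sum>i\<in>S. \<Sum>\<pi>\<in>?Perm. (y (\<pi> i))\<^sup>2)"
    by (simp add: diag N_def)
  also have "\<dots> = (\<Sum>\<pi>\<in>?Perm. \<Sum>i\<in>S. (y (\<pi> i))\<^sup>2)" by (rule sum.swap)
  also have "\<dots> = (\<Sum>\<pi>\<in>?Perm. \<Sum>i\<in>S. (y i)\<^sup>2)"
    by (intro sum.cong refl sum.reindex_bij_betw) (auto intro: permutes_imp_bij)
  finally have sumA: "N * A = fact (card S) * (\<Sum>i\<in>S. (y i)\<^sup>2)"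
    by (simp add: cardP)
  have N: "N \<noteq> 0" "N - 1 \<noteq> 0" using assms(2) by (auto simp: N_def)
  \<comment> \<open>The contributions of \<open>A\<close> add up to \<open>k * A\<close> because (N
    - k) + (k - 1) = N - 1.\<close>
  have "fact (card S) * (k * (N - k) / (N * (N - 1)) * (\<Sum>i\<in>S. (y i)\<^sup>2)
      + k * (k - 1) / (N * (N - 1)) * (\<Sum>i\<in>S. y i)\<^sup>2)
    = k * (N - k) / (N * (N - 1)) * (fact (card S) * (\<Sum>i\<in>S. (y i)\<^sup>2))
      + k * (k - 1) / (N * (N - 1)) * (fact (card S) * (\<Sum>i\<in>S. y i)\<^sup>2)"
    by (simp add: algebra_simps)
  also have "\<dots> = k * (N - k) / (N * (N - 1)) * (N * A)
      + k * (k - 1) / (N * (N - 1)) * (N * A + N * (N - 1) * B)"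
    by (simp only: sumS sumA)
  also have "\<dots> = k * A + k * (k - 1) * B"
    using N by (simp add: divide_simps) (simp add: algebra_simps)
  finally show ?thesis using main[OF assms(3)] by (simp add: k_def)
qed

section \<open>Square integrability\<close>

lemma finite_variance_integrable_square:
  assumes "real_distribution F" "finite_variance F"
  shows "integrable F (\<lambda>x. x\<^sup>2)"
proof -
  interpret real_distribution F by fact
  let ?m = "integral\<^sup>L F (\<lambda>x. x)"
  have i1: "integrable F (\<lambda>x. x)" and i2: "integrable F (\<lambda>x. (x - ?m)\<^sup>2)"
    using assms(2) by (auto simp: finite_variance_def)
  have "integrable F (\<lambda>x. (x - ?m)\<^sup>2 + (2 * ?m * x - ?m\<^sup>2))"
    using i1 i2 by simp
  then show ?thesis by (simp add: power2_diff algebra_simps)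
qed

lemma integrable_mult_of_squares:
  fixes f g :: "'a \<Rightarrow> real"
  assumes [measurable]: "f \<in> borel_measurable M" "g \<in> borel_measurable M"
    and "integrable M (\<lambda>x. (f x)\<^sup>2)" "integrable M (\<lambda>x. (g x)\<^sup>2)"
  shows "integrable M (\<lambda>x. f x * g x)"
proof (rule Bochner_Integration.integrable_bound)
  show "integrable M (\<lambda>x. (f x)\<^sup>2 + (g x)\<^sup>2)" using assms by simp
  show "AE x in M. norm (f x * g x) \<le> norm ((f x)\<^sup>2 + (g x)\<^sup>2)"
  proof (intro always_eventually allI)
    fix x
    \<comment> \<open>The first inequality bounds twice the product by the sum of the squares; the
      second allows the factor 2 to be dropped.\<close>
    have "0 \<le> (\<bar>f x\<bar> - \<bar>g x\<bar>)\<^sup>2" "0 \<le> \<bar>f x\<bar> * \<bar>g x\<bar>" by auto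
    then have "\<bar>f x\<bar> * \<bar>g x\<bar> \<le> (f x)\<^sup>2 + (g x)\<^sup>2" unfolding power2_diff power2_abs mult.assoc by linarith
    then show "norm (f x * g x) \<le> norm ((f x)\<^sup>2 + (g x)\<^sup>2)" by (simp add: abs_mult)
  qed
qed measurable

section \<open>Moments of a vector with prescribed marginals\<close>

text \<open>Nothing is assumed about the dependence between components, so the locale can be
  interpreted both for the given mix and for an arbitrary competitor.\<close>

locale finite_variance_marginals =
  fixes n :: nat and F :: "real measure" and P :: "'a measure" and X :: "nat \<Rightarrow> 'a \<Rightarrow> real"
  assumes F: "real_distribution F" and fin_var: "finite_variance F"
    and marg: "has_marginals n F P X"
begin

sublocale prob_space P
  using marg by (simp add: has_marginals_def random_vector_def)

abbreviation "mean \<equiv> integral\<^sup>L F (\<lambda>x. x)"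
abbreviation "var \<equiv> integral\<^sup>L F (\<lambda>x. (x - mean)\<^sup>2)"

lemma measurable_component: "i \<in> {1..n} \<Longrightarrow> X i \<in> borel_measurable P"
  using marg by (simp add: has_marginals_def random_vector_def)

lemma
  assumes "i \<in> {1..n}" and "f \<in> borel_measurable borel"
  shows integrable_component_iff: "integrable P (\<lambda>\<omega>. f (X i \<omega>)) \<longleftrightarrow> integrable F (f :: real \<Rightarrow> real)"
    and integral_component: "integral\<^sup>L P (\<lambda>\<omega>. f (X i \<omega>)) = integral\<^sup>L F f"
proof -
  have "F = distr P borel (X i)" using marg assms(1) by (simp add: has_marginals_def)
  then show "integrable P (\<lambda>\<omega>. f (X i \<omega>)) \<longleftrightarrow> integrable F f"
    and "integral\<^sup>L P (\<lambda>\<omega>. f (X i \<omega>)) = integral\<^sup>L F f"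
    using integrable_distr_eq[OF measurable_component[OF assms(1)] assms(2)]
      integral_distr[OF measurable_component[OF assms(1)] assms(2)] by auto
qed

lemma integrable_component: "i \<in> {1..n} \<Longrightarrow> integrable P (X i)"
  using integrable_component_iff[of i "\<lambda>x. x"] fin_var by (simp add: finite_variance_def)

lemma expectation_component: "i \<in> {1..n} \<Longrightarrow> expectation (X i) = mean"
  using integral_component[of i "\<lambda>x. x"] by simp

lemma integrable_component_square: "i \<in> {1..n} \<Longrightarrow> integrable P (\<lambda>\<omega>. (X i \<omega>)\<^sup>2)"
  using integrable_component_iff[of i "\<lambda>x. x\<^sup>2"] finite_variance_integrable_square[OF F fin_var]
  by simp

lemma expectation_component_square:
  assumes "i \<in> {1..n}"
  shows "expectation (\<lambda>\<omega>. (X i \<omega>)\<^sup>2) = var + mean\<^sup>2"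
proof -
  have "variance (X i) = var"
    using integral_component[OF assms, of "\<lambda>x. (x - mean)\<^sup>2"] expectation_component[OF assms] by simp
  then show ?thesis
    using variance_eq[OF integrable_component[OF assms] integrable_component_square[OF assms]]
      expectation_component[OF assms] by simp
qed

lemma integrable_component_mult:
  "i \<in> {1..n} \<Longrightarrow> j \<in> {1..n} \<Longrightarrow> integrable P (\<lambda>\<omega>. X i \<omega> * X j \<omega>)"
  by (intro integrable_mult_of_squares measurable_component integrable_component_square)

lemma integrable_sum_square:
  assumes "K \<subseteq> {1..n}"
  shows "integrable P (\<lambda>\<omega>. (\<Sum>i\<in>K. X i \<omega>)\<^sup>2)"
  unfolding power2_eq_square sum_product
  using assms by (intro Bochner_Integration.integrable_sum integrable_component_mult) auto

lemma expectation_component_mult: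
  assumes "i \<in> {1..n}" "j \<in> {1..n}"
  shows "expectation (\<lambda>\<omega>. X i \<omega> * X j \<omega>) = covariance P (X i) (X j) + mean\<^sup>2"
proof -
  note [simp] = integrable_component[OF assms(1)] integrable_component[OF assms(2)]
    integrable_component_mult[OF assms] expectation_component[OF assms(1)]
    expectation_component[OF assms(2)]
  have "covariance P (X i) (X j) =
      expectation (\<lambda>\<omega>. X i \<omega> * X j \<omega> - mean * X i \<omega> - mean * X j \<omega> + mean\<^sup>2)"
    unfolding covariance_def by (simp add: algebra_simps power2_eq_square)
  also have "\<dots> = expectation (\<lambda>\<omega>. X i \<omega> * X j \<omega>) - mean\<^sup>2"
    by (simp add: power2_eq_square prob_space)
  finally show ?thesis by simp
qed

text \<open>The variance of the total is nonnegative. Equality means that this variance is zero, as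
  it is for a joint mix.\<close>

lemma expectation_sum_square_ge: "(n * mean)\<^sup>2 \<le> expectation (\<lambda>\<omega>. (\<Sum>i\<in>{1..n}. X i \<omega>)\<^sup>2)"
proof -
  let ?Z = "\<lambda>\<omega>. \<Sum>i\<in>{1..n}. X i \<omega>"
  have "integrable P ?Z" by (intro Bochner_Integration.integrable_sum integrable_component)
  moreover have "expectation ?Z = n * mean"
    by (subst Bochner_Integration.integral_sum) (auto simp: integrable_component expectation_component)
  ultimately show ?thesis
    using variance_eq[of ?Z] variance_positive[of ?Z] integrable_sum_square[OF order_refl]
    by (metis diff_ge_0_iff_ge)
qed

section \<open>The lower bound and its attainment\<close>

text \<open>This is the second moment of a sum of \<open>k\<close> components under
  \<open>P_star\<close>: the variance is \<open>k * var * (1 - (k - 1) / (n - 1))\<close>. It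
  depends only on \<open>n\<close>, \<open>F\<close> and \<open>k\<close>, hence is common to all
  admissible vectors.\<close>

definition orbit_bound :: "nat \<Rightarrow> real" where
  "orbit_bound k = k * (real n - k) / (real n - 1) * var + (k * mean)\<^sup>2"

lemma sum_permutations_expectation_ge:
  assumes "n \<ge> 2" "K \<subseteq> {1..n}"
  shows "fact n * orbit_bound (card K) \<le>
    (\<Sum>\<pi> | \<pi> permutes {1..n}. expectation (\<lambda>\<omega>. (\<Sum>i\<in>\<pi> ` K. X i \<omega>)\<^sup>2))"
proof -
  define k N where "k = real (card K)" and "N = real n"
  have img: "\<pi> ` K \<subseteq> {1..n}" if "\<pi> permutes {1..n}" for \<pi>
    using assms(2) permutes_image[OF that] by blast
  have kn: "k \<le> N" using card_mono[OF _ assms(2)] by (simp add: k_def N_def)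
  have N: "N > 1" using assms(1) by (simp add: N_def)
  \<comment> \<open>This relies on \<open>k\<close> being a natural number; it fails for reals
    strictly between 0 and 1.\<close>
  have k: "k * (k - 1) \<ge> 0"
    by (cases "card K") (auto simp: k_def)
  have sq: "(\<Sum>i\<in>{1..n}. expectation (\<lambda>\<omega>. (X i \<omega>)\<^sup>2)) = N * (var + mean\<^sup>2)"
    by (simp add: expectation_component_square N_def)
  \<comment> \<open>The bound is put in the shape of the permutation identity, with the second
    moment of the total at its least value \<open>(N * mean)\<^sup>2\<close>.\<close>
  have "orbit_bound (card K) = k * (N - k) / (N * (N - 1)) * (N * (var + mean\<^sup>2))
      + k * (k - 1) / (N * (N - 1)) * (N * mean)\<^sup>2"
    using N unfolding orbit_bound_def k_def[symmetric] N_def[symmetric]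
    by (simp add: divide_simps) algebra
  also have "\<dots> \<le> k * (N - k) / (N * (N - 1)) * (\<Sum>i\<in>{1..n}. expectation (\<lambda>\<omega>. (X i \<omega>)\<^sup>2))
      + k * (k - 1) / (N * (N - 1)) * expectation (\<lambda>\<omega>. (\<Sum>i\<in>{1..n}. X i \<omega>)\<^sup>2)"
    using k N expectation_sum_square_ge unfolding sq N_def
    by (intro add_left_mono mult_left_mono) auto
  finally have "fact n * orbit_bound (card K) \<le> fact n * \<dots>"
    by (intro mult_left_mono) auto
  \<comment> \<open>Everything is gathered under one expectation so that the permutation identity
    applies pointwise, with \<open>y i = X i \<omega>\<close>.\<close>
  also have "\<dots> = expectation (\<lambda>\<omega>. fact n * (k * (N - k) / (N * (N - 1)) * (\<Sum>i\<in>{1..n}. (X i \<omega>)\<^sup>2)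
      + k * (k - 1) / (N * (N - 1)) * (\<Sum>i\<in>{1..n}. X i \<omega>)\<^sup>2))"
  proof -
    have "integrable P (\<lambda>\<omega>. \<Sum>i\<in>{1..n}. (X i \<omega>)\<^sup>2)"
      by (intro Bochner_Integration.integrable_sum integrable_component_square)
    moreover have "expectation (\<lambda>\<omega>. \<Sum>i\<in>{1..n}. (X i \<omega>)\<^sup>2) =
        (\<Sum>i\<in>{1..n}. expectation (\<lambda>\<omega>. (X i \<omega>)\<^sup>2))"
      by (intro Bochner_Integration.integral_sum integrable_component_square)
    ultimately show ?thesis
      using integrable_sum_square[OF order_refl] by simp
  qed
  also have "\<dots> = expectation (\<lambda>\<omega>. \<Sum>\<pi> | \<pi> permutes {1..n}. (\<Sum>i\<in>\<pi> ` K. X i \<omega>)\<^sup>2)"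
    using sum_permutations_square[of "{1..n}" K] assms by (simp add: k_def N_def)
  also have "\<dots> = (\<Sum>\<pi> | \<pi> permutes {1..n}. expectation (\<lambda>\<omega>. (\<Sum>i\<in>\<pi> ` K. X i \<omega>)\<^sup>2))"
    by (intro Bochner_Integration.integral_sum integrable_sum_square img) auto
  finally show ?thesis .
qed

lemma expectation_sum_square_P_star:
  assumes "n \<ge> 2" "K \<subseteq> {1..n}" and corr: "has_correlation_matrix n F P X (P_star n)"
  shows "expectation (\<lambda>\<omega>. (\<Sum>i\<in>K. X i \<omega>)\<^sup>2) = orbit_bound (card K)"
proof -
  have finK: "finite K" using assms(2) finite_subset by blast
  define k where "k = real (card K)"
  have "expectation (\<lambda>\<omega>. (\<Sum>i\<in>K. X i \<omega>)\<^sup>2) = (\<Sum>i\<in>K. \<Sum>j\<in>K. expectation (\<lambda>\<omega>. X i \<omega> * X j \<omega>))"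
    unfolding power2_eq_square sum_product using assms(2)
    by (subst Bochner_Integration.integral_sum,
        force intro!: Bochner_Integration.integrable_sum integrable_component_mult)
      (intro sum.cong refl Bochner_Integration.integral_sum integrable_component_mult; auto)
  also have "\<dots> = (\<Sum>i\<in>K. \<Sum>j\<in>K. var * P_star n i j + mean\<^sup>2)"
    using assms(2) corr unfolding has_correlation_matrix_def
    by (intro sum.cong refl) (auto simp: expectation_component_mult subset_iff)
  \<comment> \<open>The off-diagonal value is made a constant for all pairs and the diagonal a
    correction to it, so that the double sum collapses to \<open>k\<close> corrections and
    \<open>k * k\<close> constants.\<close>
  also have "\<dots> = (\<Sum>i\<in>K. \<Sum>j\<in>K. (if i = j then var * (1 + 1 / (real n - 1)) else 0)
      + (mean\<^sup>2 - var / (real n - 1)))"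
    by (intro sum.cong refl) (auto simp: P_star_def algebra_simps)
  also have "\<dots> = k * (var * (1 + 1 / (real n - 1))) + k * k * (mean\<^sup>2 - var / (real n - 1))"
    using finK by (simp add: sum.distrib k_def ring_distribs(1))
  also have "\<dots> = orbit_bound (card K)"
    unfolding orbit_bound_def k_def[symmetric] using assms(1)
    by (simp add: divide_simps) algebra
  finally show ?thesis .
qed

section \<open>From single sets to the objective\<close>

lemma nn_integral_sum_square:
  "K \<subseteq> {1..n} \<Longrightarrow> (\<integral>\<^sup>+ \<omega>. ennreal ((\<Sum>i\<in>K. X i \<omega>)\<^sup>2) \<partial>P) =
    ennreal (expectation (\<lambda>\<omega>. (\<Sum>i\<in>K. X i \<omega>)\<^sup>2))"
  by (intro nn_integral_eq_integral integrable_sum_square) auto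

text \<open>By symmetry the objective dominates the value at every rearrangement of
  \<open>\<mu>\<close>, hence their average, to which the bound for each \<open>K\<close>
  applies.\<close>

lemma orbit_bound_le_objective:
  assumes "n \<ge> 2" and sym: "symmetric_probs n M" and "\<mu> \<in> M"
  shows "(\<Sum>K\<in>Pow {1..n}. ennreal (orbit_bound (card K)) * ennreal (pmf \<mu> K)) \<le> objective n M P X"
proof -
  let ?Perm = "{\<pi>. \<pi> permutes {1..n}}"
  let ?E = "\<lambda>K. \<integral>\<^sup>+ \<omega>. ennreal ((\<Sum>i\<in>K. X i \<omega>)\<^sup>2) \<partial>P"
  have ge: "ennreal (fact n) * ennreal (orbit_bound (card K)) \<le> (\<Sum>\<pi>\<in>?Perm. ?E (\<pi> ` K))"
    if K: "K \<subseteq> {1..n}" for K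
  proof -
    have img: "\<pi> ` K \<subseteq> {1..n}" if "\<pi> \<in> ?Perm" for \<pi>
      using K permutes_image[of \<pi> "{1..n}"] that by blast
    have "ennreal (fact n) * ennreal (orbit_bound (card K)) = ennreal (fact n * orbit_bound (card K))"
      by (simp add: ennreal_mult')
    also have "\<dots> \<le> ennreal (\<Sum>\<pi>\<in>?Perm. expectation (\<lambda>\<omega>. (\<Sum>i\<in>\<pi> ` K. X i \<omega>)\<^sup>2))"
      by (intro ennreal_leI sum_permutations_expectation_ge assms K)
    also have "\<dots> = (\<Sum>\<pi>\<in>?Perm. ennreal (expectation (\<lambda>\<omega>. (\<Sum>i\<in>\<pi> ` K. X i \<omega>)\<^sup>2)))"
      by (intro sum_ennreal[symmetric] Bochner_Integration.integral_nonneg zero_le_power2)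
    also have "\<dots> = (\<Sum>\<pi>\<in>?Perm. ?E (\<pi> ` K))"
      by (intro sum.cong refl nn_integral_sum_square[symmetric] img)
    finally show ?thesis .
  qed
  \<comment> \<open>Replacing \<open>K\<close> by its image under \<open>\<pi>\<close> while keeping
    the weights of \<open>\<mu>\<close> gives the value at
    \<open>permute_prob (inv \<pi>) \<mu>\<close>, a member of \<open>M\<close>.\<close>
  have orbit: "(\<Sum>K\<in>Pow {1..n}. ?E (\<pi> ` K) * ennreal (pmf \<mu> K)) \<le> objective n M P X"
    if \<pi>: "\<pi> \<in> ?Perm" for \<pi>
  proof -
    have inv: "inv \<pi> permutes {1..n}" using \<pi> permutes_inv by blast
    have "bij_betw (image \<pi>) (Pow {1..n}) (Pow {1..n})"
      using \<pi> by (intro bij_betw_Pow permutes_imp_bij) simp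
    moreover have "pmf (permute_prob (inv \<pi>) \<mu>) (\<pi> ` K) = pmf \<mu> K" for K
      using \<pi> by (simp add: pmf_permute_prob[OF inv] image_image permutes_inverses)
    ultimately have "(\<Sum>K\<in>Pow {1..n}. ?E (\<pi> ` K) * ennreal (pmf \<mu> K)) =
        (\<Sum>K\<in>Pow {1..n}. ?E K * ennreal (pmf (permute_prob (inv \<pi>) \<mu>) K))"
      using sum.reindex_bij_betw[of "image \<pi>" "Pow {1..n}" "Pow {1..n}"
          "\<lambda>K. ?E K * ennreal (pmf (permute_prob (inv \<pi>) \<mu>) K)"] by simp
    also have "\<dots> \<le> objective n M P X"
      using sym inv assms(3) unfolding objective_def symmetric_probs_def by (intro SUP_upper) blast
    finally show ?thesis .
  qed
  have "ennreal (fact n) * (\<Sum>K\<in>Pow {1..n}. ennreal (orbit_bound (card K)) * ennreal (pmf \<mu> K)) =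
      (\<Sum>K\<in>Pow {1..n}. (ennreal (fact n) * ennreal (orbit_bound (card K))) * ennreal (pmf \<mu> K))"
    by (simp add: sum_distrib_left mult.assoc)
  also have "\<dots> \<le> (\<Sum>K\<in>Pow {1..n}. (\<Sum>\<pi>\<in>?Perm. ?E (\<pi> ` K)) * ennreal (pmf \<mu> K))"
    by (intro sum_mono mult_right_mono ge) auto
  also have "\<dots> = (\<Sum>\<pi>\<in>?Perm. \<Sum>K\<in>Pow {1..n}. ?E (\<pi> ` K) * ennreal (pmf \<mu> K))"
    unfolding sum_distrib_right by (rule sum.swap)
  also have "\<dots> \<le> (\<Sum>\<pi>\<in>?Perm. objective n M P X)"
    by (intro sum_mono orbit)
  also have "\<dots> = ennreal (fact n) * objective n M P X"
    using card_permutations[of "{1..n}" n] ennreal_of_nat_eq_real_of_nat[of "fact n"] by simp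
  \<comment> \<open>Cancellation in \<open>ennreal\<close> is valid because the factor
    \<open>fact n\<close> is neither 0 nor infinite.\<close>
  finally show ?thesis
    by (subst (asm) ennreal_mult_le_mult_iff) auto
qed

end

section \<open>Optimality of the mix\<close>

theorem theorem4:
  fixes n :: nat and F :: "real measure" and M :: "nat set pmf set"
    and P :: "'a measure" and X :: "nat \<Rightarrow> 'a \<Rightarrow> real"
  assumes "n \<ge> 2"
    and "real_distribution F"
    and "completely_mixable n F"
    and "finite_variance F"
    and "symmetric_probs n M"
    and "joint_mix n P X"
    and "neg_corr_dependent n P X"
    and "has_marginals n F P X"
    and "has_correlation_matrix n F P X (P_star n)"
  shows "has_marginals n F P X \<and>
    (\<forall>(Q :: 'b measure) Y. has_marginals n F Q Y \<longrightarrow> objective n M P X \<le> objective n M Q Y)"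
proof (intro conjI allI impI)
  show "has_marginals n F P X" by fact
next
  fix Q :: "'b measure" and Y
  assume "has_marginals n F Q Y"
  then interpret Y: finite_variance_marginals n F Q Y
    using assms by (intro finite_variance_marginals.intro)
  interpret X: finite_variance_marginals n F P X
    using assms by (intro finite_variance_marginals.intro)
  show "objective n M P X \<le> objective n M Q Y"
    unfolding objective_def[of n M P X]
  \<comment> \<open>Each value of \<open>X\<close> is compared with the whole supremum for
    \<open>Y\<close>: at the same \<open>\<mu>\<close> the value of \<open>Y\<close> could be
    smaller.\<close>
  proof (rule SUP_least)
    fix \<mu> assume "\<mu> \<in> M"
    have "(\<Sum>K\<in>Pow {1..n}. (\<integral>\<^sup>+ \<omega>. ennreal ((\<Sum>i\<in>K. X i \<omega>)\<^sup>2) \<partial>P) * ennreal (pmf \<mu> K)) =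
        (\<Sum>K\<in>Pow {1..n}. ennreal (Y.orbit_bound (card K)) * ennreal (pmf \<mu> K))"
      by (intro sum.cong refl)
        (simp add: X.nn_integral_sum_square X.expectation_sum_square_P_star assms
          X.orbit_bound_def Y.orbit_bound_def)
    also have "\<dots> \<le> objective n M Q Y"
      by (intro Y.orbit_bound_le_objective assms \<open>\<mu> \<in> M\<close>)
    finally show "(\<Sum>K\<in>Pow {1..n}. (\<integral>\<^sup>+ \<omega>. ennreal ((\<Sum>i\<in>K. X i \<omega>)\<^sup>2) \<partial>P) * ennreal (pmf \<mu> K))
        \<le> objective n M Q Y" .
  qed
qed

end
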